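(* Let $(D,\alpha)$ be the division algebra of degree three with involution of the second kind, with constants $a,b$, described in the context. There is no element of $\mathbb{G}(F)$ apart from the identity which is an eigenvector for the involution $\alpha$, i.e. $\alpha(g)\neq\pm g$ for all $g\in\mathbb{G}(F)$, $g\neq 1$. The eigenvectors of $\mathbb{U}(F)$ under $\alpha$ are the fourth roots of unity in $E^\times$: an element $g\in\mathbb{U}(F)$ satisfies $\alpha(g)=g$ or $\alpha(g)=-g$ if and only if $g$ is a fourth root of unity in $E^\times$.
   Context: Let $E/F$ be a quadratic extension of number fields, $\tau$ (also written $x\mapsto\bar x$) the non-trivial element of $\mathrm{Gal}(E/F)$, $L\supset E$ a field such that $L/F$ is Galois with cyclic group of order $6$, $\rho$ a generator of $\mathrm{Gal}(L/E)$; $\tau$ is extended to $L$ as the element of order two of $\mathrm{Gal}(L/F)$, and $M=L^\tau$. Let $a\in\mathfrak{o}_E\setminus\mathfrak{o}_F$ with $a\notin \mathrm{N}_{L/E}(L^\times)$ and $b\in M^\times$ with $\mathrm{N}_{E/F}(a)=\mathrm{N}_{M/F}(b)$. Then $D=L\oplus Lz\oplus Lz^2$ with $z^3=a$ and $zl=\rho(l)z$ for $l\in L$ is a central division algebra of degree three over $E$, and $\alpha$ is the involution of the second kind (anti-automorphism of order two restricting to $\tau$ on $E$) determined by $\alpha|_L=\tau$ and $\alpha(z)=\frac{b}{a}z^2$. Put $\mathbb{U}(F)=\{g\in D^\times\mid\alpha(g)g=1\}$ and $\mathbb{G}(F)=\{g\in\mathbb{U}(F)\mid \mathrm{N}_{rd}(g)=1\}$,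 where $\mathrm{N}_{rd}$ is the reduced norm. *)

theory Defs
  imports "HOL-Algebra.Algebraic_Closure_Type" "HOL-Algebra.Elementary_Groups"
    "HOL-Analysis.Determinants"
begin

text \<open>
  The field \<open>L\<close> is (the universe of) a type \<open>'l\<close> of class \<open>field_char_0\<close>; its subfields
  are sets of type \<open>'l set\<close>, and HOL-Algebra notions are applied to \<open>field_of_type\<close>.
\<close>

abbreviation field_of_type :: "'l::field_char_0 ring"
  where "field_of_type \<equiv> ring_of_type_algebra"

definition number_field :: "'l::field_char_0 set \<Rightarrow> bool"
  where "number_field K \<longleftrightarrow>
    subfield K field_of_type \<and> ring.finite_dimension field_of_type \<rat> K"

definition ring_of_integers :: "'l::field_char_0 set \<Rightarrow> 'l set"
  where "ring_of_integers K = {x \<in> K. algebraic_int x}"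

text \<open>\<open>galois_group K\<close> is the group of all field automorphisms of \<open>L\<close> over \<open>K\<close>.\<close>

definition galois_group :: "'l::field_char_0 set \<Rightarrow> ('l \<Rightarrow> 'l) monoid"
  where "galois_group K =
    \<lparr>carrier = {\<sigma> \<in> ring_iso field_of_type field_of_type. \<forall>x\<in>K. \<sigma> x = x},
     monoid.mult = (\<circ>), one = id\<rparr>"

text \<open>\<open>L/K\<close> is a finite Galois extension.\<close>

definition galois_over :: "'l::field_char_0 set \<Rightarrow> bool"
  where "galois_over K \<longleftrightarrow>
    subfield K field_of_type \<and>
    ring.finite_dimension field_of_type K UNIV \<and>
    {x. \<forall>\<sigma>\<in>carrier (galois_group K). \<sigma> x = x} = K"

text \<open>
  The norm of \<open>K'/K\<close>, for \<open>K \<subseteq> K' \<subseteq> L\<close> with \<open>L/K\<close> Galois, is the product over the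
  \<open>K\<close>-embeddings of \<open>K'\<close> into \<open>L\<close>; these are the distinct restrictions to \<open>K'\<close> of the
  elements of \<open>Gal(L/K)\<close>.
\<close>

definition field_norm :: "'l::field_char_0 set \<Rightarrow> 'l set \<Rightarrow> 'l \<Rightarrow> 'l"
  where "field_norm K' K x = (\<Prod>s \<in> (\<lambda>\<sigma>. restrict \<sigma> K') ` carrier (galois_group K). s x)"

text \<open>
  The cyclic algebra \<open>L \<oplus> Lz \<oplus> Lz\<^sup>2\<close> with \<open>z\<^sup>3 = a\<close> and \<open>zl = \<rho>(l)z\<close>; the triple
  \<open>(x0, x1, x2)\<close> stands for \<open>x0 + x1 z + x2 z\<^sup>2\<close>.
\<close>

definition cyclic_algebra :: "('l::field_char_0 \<Rightarrow> 'l) \<Rightarrow> 'l \<Rightarrow> ('l \<times> 'l \<times> 'l) ring"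
  where "cyclic_algebra \<rho> a =
    \<lparr>carrier = UNIV,
     monoid.mult = (\<lambda>(x0, x1, x2) (y0, y1, y2).
       (x0 * y0 + a * x1 * \<rho> y2 + a * x2 * \<rho> (\<rho> y1),
        x0 * y1 + x1 * \<rho> y0 + a * x2 * \<rho> (\<rho> y2),
        x0 * y2 + x1 * \<rho> y1 + x2 * \<rho> (\<rho> y0))),
     one = (1, 0, 0),
     ring.zero = (0, 0, 0),
     add = (\<lambda>(x0, x1, x2) (y0, y1, y2). (x0 + y0, x1 + y1, x2 + y2))\<rparr>"

definition cyc_embed :: "'l::field_char_0 \<Rightarrow> 'l \<times> 'l \<times> 'l"
  where "cyc_embed l = (l, 0, 0)"

definition cyc_z :: "'l::field_char_0 \<times> 'l \<times> 'l"
  where "cyc_z = (0, 1, 0)"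

lemma cyclic_algebra_relations:
  fixes a :: "'l::field_char_0"
  assumes "\<rho> 0 = 0" "\<rho> 1 = 1"
  defines "D \<equiv> cyclic_algebra \<rho> a"
  shows "(x0, x1, x2) = cyc_embed x0 \<oplus>\<^bsub>D\<^esub> cyc_embed x1 \<otimes>\<^bsub>D\<^esub> cyc_z
           \<oplus>\<^bsub>D\<^esub> cyc_embed x2 \<otimes>\<^bsub>D\<^esub> (cyc_z \<otimes>\<^bsub>D\<^esub> cyc_z)"
    and "cyc_z \<otimes>\<^bsub>D\<^esub> (cyc_z \<otimes>\<^bsub>D\<^esub> cyc_z) = cyc_embed a"
    and "cyc_z \<otimes>\<^bsub>D\<^esub> cyc_embed l = cyc_embed (\<rho> l) \<otimes>\<^bsub>D\<^esub> cyc_z"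
  using assms by (simp_all add: cyclic_algebra_def cyc_embed_def cyc_z_def)

lemma ring_cyclic_algebra:
  assumes add: "\<And>x y. \<rho> (x + y) = \<rho> x + \<rho> y" and mult: "\<And>x y. \<rho> (x * y) = \<rho> x * \<rho> y"
    and one: "\<rho> 1 = 1" and cube: "\<And>x. \<rho> (\<rho> (\<rho> x)) = x" and a: "\<rho> a = a"
  shows "ring (cyclic_algebra \<rho> a)"
proof -
  have zero: "\<rho> 0 = 0"
    using add[of 0 0] by simp
  show ?thesis
  proof (rule ringI)
    show "abelian_group (cyclic_algebra \<rho> a)"
    proof (rule abelian_groupI)
      fix x assume "x \<in> carrier (cyclic_algebra \<rho> a)"
      show "\<exists>y\<in>carrier (cyclic_algebra \<rho> a). y \<oplus>\<^bsub>cyclic_algebra \<rho> a\<^esub> x = \<zero>\<^bsub>cyclic_algebra \<rho> a\<^esub>"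
        by (cases x, rule bexI[of _ "- x"]) (auto simp: cyclic_algebra_def)
    qed (auto simp: cyclic_algebra_def)
    show "monoid (cyclic_algebra \<rho> a)"
      by (rule monoidI)
        (auto simp: cyclic_algebra_def add mult one cube a zero algebra_simps)
  qed (auto simp: cyclic_algebra_def add algebra_simps)
qed

text \<open>An involution of the second kind on \<open>D \<supseteq> E\<close> restricting to \<open>\<tau>\<close> on \<open>E\<close>.\<close>

definition involution_second_kind ::
  "'l::field_char_0 set \<Rightarrow> ('l \<Rightarrow> 'l) \<Rightarrow> ('l \<times> 'l \<times> 'l) ring \<Rightarrow>
    ('l \<times> 'l \<times> 'l \<Rightarrow> 'l \<times> 'l \<times> 'l) \<Rightarrow> bool"
  where "involution_second_kind E \<tau> D \<alpha> \<longleftrightarrow>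
    bij_betw \<alpha> (carrier D) (carrier D) \<and>
    (\<forall>x\<in>carrier D. \<forall>y\<in>carrier D. \<alpha> (x \<oplus>\<^bsub>D\<^esub> y) = \<alpha> x \<oplus>\<^bsub>D\<^esub> \<alpha> y) \<and>
    (\<forall>x\<in>carrier D. \<forall>y\<in>carrier D. \<alpha> (x \<otimes>\<^bsub>D\<^esub> y) = \<alpha> y \<otimes>\<^bsub>D\<^esub> \<alpha> x) \<and>
    \<alpha> \<one>\<^bsub>D\<^esub> = \<one>\<^bsub>D\<^esub> \<and>
    (\<forall>x\<in>carrier D. \<alpha> (\<alpha> x) = x) \<and> (\<exists>x\<in>carrier D. \<alpha> x \<noteq> x) \<and>
    (\<forall>e\<in>E. \<alpha> (cyc_embed e) = cyc_embed (\<tau> e))"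

text \<open>
  An \<open>E\<close>-algebra homomorphism \<open>D \<rightarrow> M\<^sub>3(L)\<close>. As \<open>D\<close> is central simple of degree three over
  \<open>E\<close>, its \<open>L\<close>-linear extension is automatically an isomorphism of \<open>D \<otimes>\<^sub>E L\<close> with \<open>M\<^sub>3(L)\<close>.
\<close>

definition splitting ::
  "'l::field_char_0 set \<Rightarrow> ('l \<times> 'l \<times> 'l) ring \<Rightarrow> ('l \<times> 'l \<times> 'l \<Rightarrow> 'l^3^3) \<Rightarrow> bool"
  where "splitting E D \<phi> \<longleftrightarrow>
    (\<forall>x\<in>carrier D. \<forall>y\<in>carrier D. \<phi> (x \<oplus>\<^bsub>D\<^esub> y) = \<phi> x + \<phi> y) \<and>
    (\<forall>x\<in>carrier D. \<forall>y\<in>carrier D. \<phi> (x \<otimes>\<^bsub>D\<^esub> y) = \<phi> x ** \<phi> y) \<and>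
    (\<forall>e\<in>E. \<phi> (cyc_embed e) = mat e)"

lemma splitting_exists:
  fixes a :: "'l::field_char_0"
  assumes add: "\<And>x y. \<rho> (x + y) = \<rho> x + \<rho> y" and mult: "\<And>x y. \<rho> (x * y) = \<rho> x * \<rho> y"
    and one: "\<rho> 1 = 1" and cube: "\<And>x. \<rho> (\<rho> (\<rho> x)) = x"
    and E: "\<And>x. x \<in> E \<Longrightarrow> \<rho> x = x" and a: "a \<in> E"
  shows "splitting E (cyclic_algebra \<rho> a) (\<lambda>(x0, x1, x2). vector
    [vector [x0, x1, x2],
     vector [a * \<rho> x2, \<rho> x0, \<rho> x1],
     vector [a * \<rho> (\<rho> x1), a * \<rho> (\<rho> x2), \<rho> (\<rho> x0)]])"
  unfolding splitting_def
  by (auto simp: cyclic_algebra_def cyc_embed_def vec_eq_iff forall_3 matrix_matrix_mult_def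
      sum_3 vector_3 mat_def add mult one cube E[OF a] E algebra_simps add[of 0 0, simplified])

text \<open>The choice of the splitting is immaterial by the Skolem--Noether theorem.\<close>

definition reduced_norm ::
  "'l::field_char_0 set \<Rightarrow> ('l \<times> 'l \<times> 'l) ring \<Rightarrow> 'l \<times> 'l \<times> 'l \<Rightarrow> 'l"
  where "reduced_norm E D g = det ((SOME \<phi>. splitting E D \<phi>) g)"

definition unitary_group ::
  "('l::field_char_0 \<times> 'l \<times> 'l) ring \<Rightarrow> ('l \<times> 'l \<times> 'l \<Rightarrow> 'l \<times> 'l \<times> 'l) \<Rightarrow>
    ('l \<times> 'l \<times> 'l) set"
  where "unitary_group D \<alpha> = {g \<in> Units D. \<alpha> g \<otimes>\<^bsub>D\<^esub> g = \<one>\<^bsub>D\<^esub>}"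

definition special_unitary_group ::
  "'l::field_char_0 set \<Rightarrow> ('l \<times> 'l \<times> 'l) ring \<Rightarrow>
    ('l \<times> 'l \<times> 'l \<Rightarrow> 'l \<times> 'l \<times> 'l) \<Rightarrow> ('l \<times> 'l \<times> 'l) set"
  where "special_unitary_group E D \<alpha> = {g \<in> unitary_group D \<alpha>. reduced_norm E D g = 1}"

end

theory Submission
  imports Defs
begin

text \<open>
  If \<open>\<alpha>(g) = \<plusminus>g\<close> and \<open>\<alpha>(g)g = 1\<close>, then \<open>g\<^sup>2 = \<plusminus>1\<close>. Since \<open>a\<close> is not a norm, a left ideal of \<open>D\<close>
  is \<open>0\<close> or \<open>D\<close>, so \<open>D\<close> has no zero divisors and \<open>g\<^sup>2 = 1\<close> forces \<open>g = \<plusminus>1\<close>. If \<open>g\<^sup>2 = -1\<close>, the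
  reduced norm \<open>d\<close> of \<open>g\<close> satisfies \<open>d\<^sup>2 = (-1)\<^sup>3 = -1\<close> because the degree of \<open>D\<close> is odd; as \<open>d \<in> E\<close>
  is central, \<open>(g - d)(g + d) = 0\<close> and \<open>g = \<plusminus>d\<close>. A scalar \<open>\<zeta>\<close> has reduced norm \<open>\<zeta>\<^sup>3\<close>, which together
  with \<open>\<zeta>\<^sup>4 = 1\<close> leaves only \<open>\<zeta> = 1\<close> in the special unitary group.
\<close>

section \<open>Galois groups\<close>

lemma carrier_galois_group:
  "carrier (galois_group K) = {\<sigma>. bij \<sigma> \<and> (\<forall>x y. \<sigma> (x + y) = \<sigma> x + \<sigma> y) \<and>
     (\<forall>x y. \<sigma> (x * y) = \<sigma> x * \<sigma> y) \<and> \<sigma> 1 = 1 \<and> (\<forall>x\<in>K. \<sigma> x = x)}"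
  unfolding galois_group_def ring_iso_def ring_hom_def
  by (auto simp: ring_of_type_algebra_def)

lemma mult_galois_group: "\<sigma> \<otimes>\<^bsub>galois_group K\<^esub> \<sigma>' = \<sigma> \<circ> \<sigma>'"
  and one_galois_group: "\<one>\<^bsub>galois_group K\<^esub> = id"
  by (simp_all add: galois_group_def)

lemma group_galois_group: "group (galois_group K)"
proof (rule groupI)
  fix \<sigma> assume \<sigma>: "\<sigma> \<in> carrier (galois_group K)"
  then have bij: "bij \<sigma>"
    by (simp add: carrier_galois_group)
  have inv_eq: "inv_into UNIV \<sigma> x = y" if "x = \<sigma> y" for x y
    using bij that by (simp add: bij_is_inj)
  have "inv_into UNIV \<sigma> \<in> carrier (galois_group K)"
    unfolding carrier_galois_group
  proof (intro CollectI conjI allI ballI)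
    show "bij (inv_into UNIV \<sigma>)"
      using bij by (rule bij_imp_bij_inv)
  next
    fix x y
    show "inv_into UNIV \<sigma> (x + y) = inv_into UNIV \<sigma> x + inv_into UNIV \<sigma> y"
      "inv_into UNIV \<sigma> (x * y) = inv_into UNIV \<sigma> x * inv_into UNIV \<sigma> y"
      using \<sigma> by (auto intro!: inv_eq simp: carrier_galois_group bij_is_surj surj_f_inv_f)
  qed (use \<sigma> in \<open>auto intro!: inv_eq simp: carrier_galois_group\<close>)
  moreover have "inv_into UNIV \<sigma> \<circ> \<sigma> = id"
    using bij by (simp add: bij_is_inj)
  ultimately show "\<exists>\<sigma>'\<in>carrier (galois_group K).
      \<sigma>' \<otimes>\<^bsub>galois_group K\<^esub> \<sigma> = \<one>\<^bsub>galois_group K\<^esub>"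
    by (auto simp: mult_galois_group one_galois_group)
qed (simp_all add: carrier_galois_group mult_galois_group one_galois_group bij_comp comp_assoc)

lemma galois_group_pow: "\<sigma> [^]\<^bsub>galois_group K\<^esub> (n::nat) = \<sigma> ^^ n"
proof (induction n)
  case (Suc n)
  then show ?case
    by (simp add: nat_pow_def galois_group_def funpow_swap1 fun_eq_iff)
qed (simp add: nat_pow_def galois_group_def)

section \<open>Subfields and quadratic extensions\<close>

lemma subfield_closed:
  fixes K :: "'l::field_char_0 set"
  assumes "subfield K field_of_type"
  shows "0 \<in> K" "1 \<in> K" "x \<in> K \<Longrightarrow> y \<in> K \<Longrightarrow> x + y \<in> K" "x \<in> K \<Longrightarrow> y \<in> K \<Longrightarrow> x * y \<in> K"
    and "x \<in> K \<Longrightarrow> - x \<in> K" "x \<in> K \<Longrightarrow> inverse x \<in> K"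
proof -
  interpret field "field_of_type :: 'l ring"
    by (rule field_from_type_algebra)
  note K = subringE[OF subfieldE(1)[OF assms]]
  show K0: "0 \<in> K" and "1 \<in> K"
    and "x \<in> K \<Longrightarrow> y \<in> K \<Longrightarrow> x + y \<in> K" "x \<in> K \<Longrightarrow> y \<in> K \<Longrightarrow> x * y \<in> K"
    using K(2,3,6,7) by (simp_all add: ring_of_type_algebra_def)
  have "\<ominus>\<^bsub>field_of_type\<^esub> x = - x" for x :: 'l
    by (rule minus_equality) (simp_all add: ring_of_type_algebra_def)
  with K(5) show "x \<in> K \<Longrightarrow> - x \<in> K"
    by metis
  show "inverse x \<in> K" if "x \<in> K"
  proof (cases "x = 0")
    case False
    then have "x \<in> K - {\<zero>\<^bsub>field_of_type\<^esub>}"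
      using that by (simp add: ring_of_type_algebra_def)
    from subfield_m_inv(1,2)[OF assms this] False show ?thesis
      by (simp add: ring_of_type_algebra_def) (metis inverse_unique)
  qed (use K0 in simp)
qed

text \<open>Any \<open>e\<close> in \<open>E\<close> outside \<open>F\<close> is linearly
  independent of \<open>1\<close>, and two independent vectors span a space of dimension
  two.\<close>

lemma quadratic_extension_basis:
  fixes F E :: "'l::field_char_0 set"
  assumes F: "subfield F field_of_type"
    and "F \<subseteq> E" and dim: "ring.dimension field_of_type 2 F E"
  obtains e where "e \<in> E" "e \<notin> F" "\<And>x. x \<in> E \<longleftrightarrow> (\<exists>p\<in>F. \<exists>q\<in>F. x = p + q * e)"
proof -
  interpret field "field_of_type :: 'l ring"
    by (rule field_from_type_algebra)
  note simps = ring_of_type_algebra_def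
  have "F \<noteq> E"
    using dimension_is_inj[OF F dim] dimension_one[OF F] by force
  then obtain e where e: "e \<in> E" "e \<notin> F"
    using \<open>F \<subseteq> E\<close> by blast
  have one: "Span F [1] = F"
    by (auto simp: set_eq_iff line_extension_mem_iff) (auto simp: simps)
  have "independent F [1]"
    by (rule li_Cons[OF _ _ li_Nil]) (simp_all add: simps ring.Span.simps[OF ring_axioms, unfolded simps])
  then have "independent F [e, 1]"
    by (rule li_Cons[rotated 2]) (use e(2) one in \<open>simp_all add: simps\<close>)
  then have "Span F [e, 1] = E"
    using independent_length_eq_dimension[OF F dim, of "[e, 1]"] e subfield_closed(2)[OF F] \<open>F \<subseteq> E\<close>
    by auto
  then have "E = line_extension F e (Span F [1])"
    by simp
  then have "x \<in> E \<longleftrightarrow> (\<exists>q\<in>F. \<exists>p\<in>Span F [1]. x = q * e + p)" for x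
    by (simp only: line_extension_mem_iff) (simp add: simps)
  with one have "x \<in> E \<longleftrightarrow> (\<exists>p\<in>F. \<exists>q\<in>F. x = p + q * e)" for x
    by (metis add.commute)
  with e show thesis
    using that by blast
qed

text \<open>With \<open>e\<close> as in the basis, \<open>e\<close> is a root of a monic quadratic
  over \<open>F\<close> whose roots have sum \<open>q\<close>. An automorphism over \<open>F\<close>
  therefore sends \<open>e\<close> to \<open>e\<close> or to the conjugate \<open>q - e\<close>,
  which again lies in \<open>E\<close> and is sent back to \<open>e\<close>.\<close>

lemma galois_quadratic:
  fixes F E :: "'l::field_char_0 set"
  assumes F: "subfield F field_of_type" and E: "subfield E field_of_type"
    and FE: "F \<subseteq> E" and dim: "ring.dimension field_of_type 2 F E"
    and \<sigma>: "\<sigma> \<in> carrier (galois_group F)" and x: "x \<in> E"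
  shows "\<sigma> x \<in> E" "\<sigma> (\<sigma> x) = x"
proof -
  have add: "\<sigma> (u + v) = \<sigma> u + \<sigma> v" and mult: "\<sigma> (u * v) = \<sigma> u * \<sigma> v" for u v
    using \<sigma> by (auto simp: carrier_galois_group)
  have fixed: "\<sigma> u = u" if "u \<in> F" for u
    using \<sigma> that by (auto simp: carrier_galois_group)
  obtain e where e: "e \<in> E" and basis: "\<And>x. x \<in> E \<longleftrightarrow> (\<exists>p\<in>F. \<exists>q\<in>F. x = p + q * e)"
    using quadratic_extension_basis[OF F FE dim] by metis
  have "e * e \<in> E"
    using e subfield_closed(4)[OF E] by blast
  then obtain p q where p: "p \<in> F" and q: "q \<in> F" and ee: "e * e = p + q * e"
    using basis by blast
  have "\<sigma> e * \<sigma> e = p + q * \<sigma> e"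
    using ee by (metis add mult fixed p q)
  with ee have "(\<sigma> e - e) * (\<sigma> e - (q - e)) = 0"
    by (simp add: algebra_simps)
  then have cases: "\<sigma> e = e \<or> \<sigma> e = q - e"
    by auto
  have "\<sigma> (\<sigma> e) = e" if \<sigma>e: "\<sigma> e = q - e"
  proof -
    have "\<sigma> e + \<sigma> (\<sigma> e) = q"
      using \<sigma>e add[of e "\<sigma> e"] fixed[OF q] by simp
    moreover have "e + \<sigma> e = q"
      using \<sigma>e by simp
    ultimately show ?thesis
      by (metis add.commute add_left_imp_eq)
  qed
  with cases have \<sigma>\<sigma>: "\<sigma> (\<sigma> e) = e"
    by auto
  have "\<sigma> e \<in> E"
    using cases e q FE subfield_closed(3,5)[OF E] by (metis diff_conv_add_uminus subsetD)
  moreover obtain u v where uv: "u \<in> F" "v \<in> F" "x = u + v * e"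
    using x basis by blast
  ultimately show "\<sigma> x \<in> E"
    using FE subfield_closed(3,4)[OF E] by (simp add: add mult fixed subset_eq)
  show "\<sigma> (\<sigma> x) = x"
    using \<sigma>\<sigma> uv by (simp add: add mult fixed)
qed

text \<open>A generator \<open>\<sigma>\<close> of the group of \<open>L/F\<close> acts on
  \<open>E\<close> with order exactly two, so the elements fixing \<open>E\<close> pointwise are its
  even powers. Hence \<open>\<rho>\<close> is \<open>\<sigma> ^^ 2\<close> or
  \<open>\<sigma> ^^ 4\<close>, and everything is read off from
  \<open>\<sigma> ^^ 6 = id\<close>.\<close>

lemma cyclic_sextic_galois:
  fixes F E :: "'l::field_char_0 set"
  assumes galois: "galois_over F" and E: "subfield E field_of_type"
    and FE: "F \<subseteq> E" and dim: "ring.dimension field_of_type 2 F E"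
    and cyclic: "cyclic_group (galois_group F)" and order: "Coset.order (galois_group F) = 6"
    and \<rho>: "\<rho> \<in> carrier (galois_group E)"
    and gen: "generate (galois_group E) {\<rho>} = carrier (galois_group E)"
  shows "\<rho> (\<rho> (\<rho> x)) = x" "\<rho> x = x \<Longrightarrow> x \<in> E"
    and "field_norm UNIV E x = x * \<rho> x * \<rho> (\<rho> x)"
proof -
  interpret GF: group "galois_group F"
    by (rule group_galois_group)
  interpret GE: group "galois_group E"
    by (rule group_galois_group)
  have F: "subfield F field_of_type"
    and F_fixed: "\<And>x. (\<And>\<sigma>. \<sigma> \<in> carrier (galois_group F) \<Longrightarrow> \<sigma> x = x) \<Longrightarrow> x \<in> F"
    using galois by (auto simp: galois_over_def)
  have fin: "finite (carrier (galois_group F))"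
    using order by (intro card_ge_0_finite) (simp add: Coset.order_def)
  obtain \<sigma> where \<sigma>: "\<sigma> \<in> carrier (galois_group F)"
    and "subgroup_generated (galois_group F) {\<sigma>} = galois_group F"
    using cyclic by (auto simp: cyclic_group_def)
  then have "generate (galois_group F) {\<sigma>} = carrier (galois_group F)"
    using carrier_subgroup_generated[of "galois_group F" "{\<sigma>}"] \<sigma> by simp
  then have powers: "carrier (galois_group F) = range (\<lambda>n::nat. \<sigma> ^^ n)"
    using GF.generate_pow_on_finite_carrier[OF fin \<sigma>]
    by (simp add: galois_group_pow full_SetCompr_eq)
  have six: "\<sigma> ^^ 6 = id"
    using GF.pow_order_eq_1[OF \<sigma>] order by (simp add: galois_group_pow) (simp add: galois_group_def)
  \<comment> \<open>Otherwise the powers of \<open>\<sigma>\<close> would be at most two in number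
    instead of six. This later excludes \<open>\<rho> = id\<close>.\<close>
  have not_invol: "\<sigma> ^^ 2 \<noteq> id"
  proof
    assume two: "\<sigma> ^^ 2 = id"
    have "\<sigma> ^^ n \<in> {id, \<sigma>}" for n
    proof -
      have "\<sigma> ^^ n = \<sigma> ^^ (n mod 2)"
        using two by (simp add: funpow_mod_eq fun_eq_iff)
      moreover have "n mod 2 = 0 \<or> n mod 2 = 1"
        by auto
      ultimately show ?thesis
        by auto
    qed
    then have "carrier (galois_group F) \<subseteq> {id, \<sigma>}"
      by (auto simp: powers)
    then have "card (carrier (galois_group F)) \<le> card {id, \<sigma>}"
      by (intro card_mono) auto
    also have "\<dots> \<le> 2"
      by (simp add: card_insert_if)
    finally show False
      using order by (simp add: Coset.order_def)
  qed
  have add: "\<sigma> (u + v) = \<sigma> u + \<sigma> v" and mult: "\<sigma> (u * v) = \<sigma> u * \<sigma> v" for u v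
    using \<sigma> by (auto simp: carrier_galois_group)
  have diff: "\<sigma> (u - v) = \<sigma> u - \<sigma> v" for u v
    using add[of "u - v" v] by simp
  have divide: "\<sigma> (u / v) = \<sigma> u / \<sigma> v" if "\<sigma> v \<noteq> 0" for u v
  proof -
    have "v \<noteq> 0"
      using that diff[of 0 0] by auto
    then show ?thesis
      using mult[of "u / v" v] that by (simp add: field_simps)
  qed
  \<comment> \<open>An element fixed by the generator is fixed by all its powers, that is by the
    whole group, whose fixed field is \<open>F\<close>.\<close>
  have in_F: "x \<in> F" if "\<sigma> x = x" for x
  proof (rule F_fixed)
    fix \<sigma>' assume "\<sigma>' \<in> carrier (galois_group F)"
    then obtain n where "\<sigma>' = \<sigma> ^^ n"
      by (auto simp: powers)
    moreover have "(\<sigma> ^^ n) x = x"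
      by (induction n) (use that in auto)
    ultimately show "\<sigma>' x = x"
      by simp
  qed
  note quad = galois_quadratic[OF F E FE dim \<sigma>]
  have even_pow: "(\<sigma> ^^ (2 * n)) x = x" if "x \<in> E" for x n
    by (induction n) (use that quad in auto)
  obtain e where e: "e \<in> E" "e \<notin> F"
    using quadratic_extension_basis[OF F FE dim] by metis
  have \<sigma>e: "\<sigma> e \<noteq> e"
    using in_F e by blast
  \<comment> \<open>Split \<open>2x = (x + \<sigma> x) + (x - \<sigma> x)\<close> into eigenvectors of \<open>\<sigma>\<close>; both \<open>x - \<sigma> x\<close> and
    \<open>e - \<sigma> e\<close> change sign under \<open>\<sigma>\<close>, so their quotient lies in \<open>F\<close>.\<close>
  have in_E: "x \<in> E" if x: "\<sigma> (\<sigma> x) = x" for x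
  proof -
    define f where "f = (x - \<sigma> x) / (e - \<sigma> e)"
    have "\<sigma> f = (\<sigma> x - x) / (\<sigma> e - e)"
      using \<sigma>e quad(2)[OF e(1)] x by (simp add: f_def divide diff)
    also have "\<dots> = f"
      unfolding f_def by (metis minus_diff_eq minus_divide_divide)
    finally have "f \<in> E"
      using in_F FE by blast
    moreover have "x + \<sigma> x \<in> E"
      using in_F[of "x + \<sigma> x"] FE x by (auto simp: add add.commute)
    moreover have "e - \<sigma> e \<in> E"
      using e(1) quad(1) subfield_closed(3,5)[OF E] by (metis diff_conv_add_uminus)
    ultimately have "inverse (1 + 1) * (x + \<sigma> x + f * (e - \<sigma> e)) \<in> E"
      by (meson subfield_closed(2,3,4,6)[OF E])
    moreover have "f * (e - \<sigma> e) = x - \<sigma> x"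
      using \<sigma>e by (simp add: f_def)
    ultimately show ?thesis
      by simp
  qed
  have GE_eq: "carrier (galois_group E) = {id, \<sigma> ^^ 2, \<sigma> ^^ 4}"
  proof (intro equalityI subsetI)
    fix \<sigma>' assume \<sigma>': "\<sigma>' \<in> carrier (galois_group E)"
    then have "\<sigma>' \<in> carrier (galois_group F)"
      using FE by (auto simp: carrier_galois_group)
    then obtain n where n: "\<sigma>' = \<sigma> ^^ n"
      by (auto simp: powers)
    \<comment> \<open>Even powers fix \<open>E\<close>, so an odd power acts on \<open>e\<close>
      like \<open>\<sigma>\<close>, which moves it.\<close>
    have "even n"
    proof (rule ccontr)
      assume "odd n"
      then obtain k where "n = Suc (2 * k)"
        by (auto elim: oddE)
      with n e(1) even_pow \<sigma>' have "\<sigma> e = e"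
        by (auto simp: carrier_galois_group)
      with \<sigma>e show False ..
    qed
    have "\<sigma>' = \<sigma> ^^ (n mod 6)"
      using six n by (simp add: funpow_mod_eq fun_eq_iff)
    moreover have "n mod 6 \<in> {0, 2, 4}"
      using \<open>even n\<close> by auto presburger
    ultimately show "\<sigma>' \<in> {id, \<sigma> ^^ 2, \<sigma> ^^ 4}"
      by auto
  next
    fix \<sigma>' assume "\<sigma>' \<in> {id, \<sigma> ^^ 2, \<sigma> ^^ 4}"
    then obtain n where n: "\<sigma>' = \<sigma> ^^ (2 * n)"
      by (metis empty_iff funpow_0 insert_iff mult_0_right mult_1_right num_double
          numeral_times_numeral eq_id_iff)
    then have "\<sigma>' \<in> carrier (galois_group F)"
      by (simp add: powers)
    then show "\<sigma>' \<in> carrier (galois_group E)"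
      using even_pow n by (auto simp: carrier_galois_group)
  qed
  have "\<rho> \<noteq> id"
  proof
    assume "\<rho> = id"
    then have "carrier (galois_group E) = {id}"
      using gen GE.generate_one by (simp add: galois_group_def)
    with not_invol GE_eq show False
      by auto
  qed
  with \<rho> GE_eq have \<rho>_cases: "\<rho> = \<sigma> ^^ 2 \<or> \<rho> = \<sigma> ^^ 4"
    by auto
  have six': "\<sigma> (\<sigma> (\<sigma> (\<sigma> (\<sigma> (\<sigma> x))))) = x" for x
    using fun_cong[OF six, of x] by (simp add: eval_nat_numeral)
  have \<rho>\<rho>: "carrier (galois_group E) = {id, \<rho>, \<rho> \<circ> \<rho>}"
    using \<rho>_cases by (auto simp: GE_eq fun_eq_iff eval_nat_numeral six')
  from \<rho>_cases show cube: "\<rho> (\<rho> (\<rho> x)) = x" for x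
    by (auto simp: eval_nat_numeral six')
  \<comment> \<open>In both cases \<open>x\<close> is fixed by \<open>\<sigma> ^^ 2\<close>: if
    \<open>\<rho> = \<sigma> ^^ 4\<close>, cancel four of the six applications in
    \<open>\<sigma> ^^ 6 = id\<close>.\<close>
  from \<rho>_cases show "x \<in> E" if "\<rho> x = x"
  proof
    assume "\<rho> = \<sigma> ^^ 2"
    with that show ?thesis
      by (intro in_E) (simp add: eval_nat_numeral)
  next
    assume "\<rho> = \<sigma> ^^ 4"
    with that have "\<sigma> (\<sigma> (\<sigma> (\<sigma> x))) = x"
      by (simp add: eval_nat_numeral)
    then have "\<sigma> (\<sigma> x) = x"
      using six'[of x] by simp
    then show ?thesis
      by (rule in_E)
  qed
  \<comment> \<open>\<open>field_norm\<close> is a product over a set of maps, so it has three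
    factors only once \<open>id\<close>, \<open>\<rho>\<close> and
    \<open>\<rho> \<circ> \<rho>\<close> are known to be distinct.\<close>
  have "inj \<rho>"
    by (metis cube injI)
  then have "\<rho> \<circ> \<rho> \<noteq> \<rho>"
    using \<open>\<rho> \<noteq> id\<close> by (auto simp: fun_eq_iff inj_eq)
  moreover have "\<rho> \<circ> \<rho> \<noteq> id"
    using \<open>\<rho> \<noteq> id\<close> cube by (auto simp: fun_eq_iff) metis
  ultimately show "field_norm UNIV E x = x * \<rho> x * \<rho> (\<rho> x)"
    using \<open>\<rho> \<noteq> id\<close> by (simp add: field_norm_def restrict_UNIV \<rho>\<rho> eq_commute[of id] mult.assoc)
qed

section \<open>Cyclic algebras of degree three\<close>

text \<open>Isolates what the arithmetic of \<open>D\<close> rests on; the fixed field of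
  \<open>\<rho>\<close> takes the place of \<open>E\<close>. In \<open>not_norm\<close> the value
  \<open>c = 0\<close> is allowed, so it includes \<open>a \<noteq> 0\<close>.\<close>

locale cyclic_cubic =
  fixes \<rho> :: "'l::field_char_0 \<Rightarrow> 'l" and a :: 'l
  assumes add: "\<rho> (x + y) = \<rho> x + \<rho> y" and mult: "\<rho> (x * y) = \<rho> x * \<rho> y"
    and one: "\<rho> 1 = 1" and cube: "\<rho> (\<rho> (\<rho> x)) = x" and base: "\<rho> a = a"
    and not_norm: "a \<noteq> c * \<rho> c * \<rho> (\<rho> c)"
begin

abbreviation A where "A \<equiv> cyclic_algebra \<rho> a"

sublocale ring A
  by (rule ring_cyclic_algebra[OF add mult one cube base])

lemma carrier_A: "u \<in> carrier A"
  by (simp add: cyclic_algebra_def)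

lemma zero: "\<rho> 0 = 0"
  using add[of 0 0] by simp

lemma uminus: "\<rho> (- x) = - \<rho> x"
  using add[of x "- x"] zero by (simp add: add_eq_0_iff)

lemma diff: "\<rho> (x - y) = \<rho> x - \<rho> y"
  using add[of "x - y" y] by simp

lemma a_inv_A: "\<ominus>\<^bsub>A\<^esub> x = - x"
  by (rule minus_equality) (auto simp: cyclic_algebra_def split: prod.splits)

text \<open>
  A left ideal is a left \<open>L\<close>-subspace stable under \<open>z\<close>. If it contains \<open>z + c\<close>, it contains
  \<open>a + c \<rho>(c) \<rho>\<^sup>2(c)\<close>; if instead it is spanned by \<open>p + q z + z\<^sup>2\<close>, then \<open>a = q \<rho>(q) \<rho>\<^sup>2(q)\<close>.
\<close>

lemma left_ideal_one:
  assumes plus: "\<And>x y. x \<in> I \<Longrightarrow> y \<in> I \<Longrightarrow> x \<oplus>\<^bsub>A\<^esub> y \<in> I"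
    and times: "\<And>r x. x \<in> I \<Longrightarrow> r \<otimes>\<^bsub>A\<^esub> x \<in> I"
    and v: "v \<in> I" "v \<noteq> \<zero>\<^bsub>A\<^esub>"
  shows "\<one>\<^bsub>A\<^esub> \<in> I"
proof -
  have scale: "(l * x0, l * x1, l * x2) \<in> I" if "(x0, x1, x2) \<in> I" for l x0 x1 x2
    using times[OF that, of "(l, 0, 0)"] by (simp add: cyclic_algebra_def zero)
  have shift: "(a * \<rho> x2, \<rho> x0, \<rho> x1) \<in> I" if "(x0, x1, x2) \<in> I" for x0 x1 x2
    using times[OF that, of "(0, 1, 0)"] by (simp add: cyclic_algebra_def zero)
  have comb: "(x0 + l * y0, x1 + l * y1, x2 + l * y2) \<in> I"
    if "(x0, x1, x2) \<in> I" "(y0, y1, y2) \<in> I" for l x0 x1 x2 y0 y1 y2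
    using plus[OF that(1) scale[OF that(2), of l]] by (simp add: cyclic_algebra_def)
  have deg0: "(1, 0, 0) \<in> I" if "(c, 0, 0) \<in> I" "c \<noteq> 0" for c
    using scale[OF that(1), of "inverse c"] that(2) by simp
  have deg1: "(1, 0, 0) \<in> I" if 0: "(c, d, 0) \<in> I" and "d \<noteq> 0" for c d
  proof -
    define c' where "c' = c / d"
    have 0: "(c', 1, 0) \<in> I"
      using scale[OF 0, of "inverse d"] \<open>d \<noteq> 0\<close> by (simp add: c'_def field_simps)
    have 1: "(0, \<rho> c', 1) \<in> I"
      using shift[OF 0] by (simp add: zero one)
    have 2: "(a, 0, \<rho> (\<rho> c')) \<in> I"
      using shift[OF 1] by (simp add: zero one)
    \<comment> \<open>Elimination from the top: the second vector clears the coefficient of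
      \<open>z\<close> squared in the third, then the first clears that of \<open>z\<close>.\<close>
    have "(a + c' * \<rho> c' * \<rho> (\<rho> c'), 0, 0) \<in> I"
      using comb[OF comb[OF 2 1, of "- \<rho> (\<rho> c')"] 0, of "\<rho> c' * \<rho> (\<rho> c')"]
      by (simp add: algebra_simps)
    \<comment> \<open>The norm form has odd degree, so a zero would exhibit \<open>a\<close> as the
      norm of \<open>- c'\<close>.\<close>
    moreover have "a + c' * \<rho> c' * \<rho> (\<rho> c') \<noteq> 0"
      using not_norm[of "- c'"] by (simp add: uminus add_eq_0_iff2)
    ultimately show ?thesis
      by (rule deg0)
  qed
  have deg2: "(1, 0, 0) \<in> I" if "(x0, x1, x2) \<in> I" and "x2 \<noteq> 0" for x0 x1 x2
  proof -
    define p q where "p = x0 / x2" and "q = x1 / x2"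
    have pq: "(p, q, 1) \<in> I"
      using scale[OF that(1), of "inverse x2"] \<open>x2 \<noteq> 0\<close> by (simp add: p_def q_def field_simps)
    have "(a, \<rho> p, \<rho> q) \<in> I"
      using shift[OF pq] by (simp add: one)
    from comb[OF this pq, of "- \<rho> q"] have r: "(a - \<rho> q * p, \<rho> p - \<rho> q * q, 0) \<in> I"
      by simp
    show ?thesis
    proof (cases "\<rho> p = \<rho> q * q")
      case True
      have "a \<noteq> \<rho> q * p"
      proof
        assume "a = \<rho> q * p"
        \<comment> \<open>Applying \<open>\<rho>\<close> leaves \<open>a\<close> unchanged and turns
          \<open>p\<close> into \<open>\<rho> p\<close>, which is \<open>\<rho> q * q\<close> in
          this case.\<close>
        then have "a = \<rho> (\<rho> q) * \<rho> p"
          using base by (metis mult)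
        with True not_norm[of q] show False
          by (simp add: mult_ac)
      qed
      with r True show ?thesis
        using deg0[of "a - \<rho> q * p"] by simp
    next
      case False
      with r show ?thesis
        using deg1 by simp
    qed
  qed
  obtain x0 x1 x2 where "v = (x0, x1, x2)"
    by (cases v) auto
  with v deg0[of x0] deg1[of x0 x1] deg2[of x0 x1 x2] show ?thesis
    by (auto simp: cyclic_algebra_def)
qed

text \<open>The left annihilator of \<open>y\<close> is a left ideal; if it contains a nonzero
  \<open>x\<close>, it contains the identity, which forces \<open>y\<close> to vanish.\<close>

lemma no_zero_divisors:
  assumes "x \<otimes>\<^bsub>A\<^esub> y = \<zero>\<^bsub>A\<^esub>"
  shows "x = \<zero>\<^bsub>A\<^esub> \<or> y = \<zero>\<^bsub>A\<^esub>"
proof (rule ccontr)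
  assume nz: "\<not> ?thesis"
  have "\<one>\<^bsub>A\<^esub> \<in> {v. v \<otimes>\<^bsub>A\<^esub> y = \<zero>\<^bsub>A\<^esub>}"
    by (rule left_ideal_one[of _ x]) (use assms nz in \<open>auto simp: l_distr m_assoc carrier_A\<close>)
  with nz show False
    by (simp add: carrier_A)
qed

text \<open>Being fixed by \<open>\<rho>\<close>, \<open>d\<close> commutes with \<open>L\<close>
  and with \<open>z\<close>, so the difference of squares factors as in a commutative ring.\<close>

lemma square_eq_scalar:
  assumes sq: "g \<otimes>\<^bsub>A\<^esub> g = cyc_embed (d * d)" and d: "\<rho> d = d"
  shows "g = cyc_embed d \<or> g = cyc_embed (- d)"
proof -
  obtain x0 x1 x2 where g: "g = (x0, x1, x2)"
    by (cases g) auto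
  have "(x0 - d, x1, x2) \<otimes>\<^bsub>A\<^esub> (x0 + d, x1, x2) = \<zero>\<^bsub>A\<^esub>"
    using sq by (simp add: g cyclic_algebra_def cyc_embed_def add d algebra_simps)
  from no_zero_divisors[OF this] show ?thesis
    by (auto simp: g cyclic_algebra_def cyc_embed_def add_eq_0_iff2)
qed

text \<open>The required \<open>d\<close> is the determinant of \<open>g\<close> in the explicit
  splitting by 3 x 3 matrices, where \<open>- 1\<close> has determinant \<open>- 1\<close>.\<close>

lemma square_eq_minus_one:
  assumes sq: "g \<otimes>\<^bsub>A\<^esub> g = cyc_embed (- 1)"
  obtains d where "\<rho> d = d" "d * d = - 1"
proof -
  define \<phi> :: "'l \<times> 'l \<times> 'l \<Rightarrow> 'l^3^3" where "\<phi> = (\<lambda>(x0, x1, x2). vector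
    [vector [x0, x1, x2],
     vector [a * \<rho> x2, \<rho> x0, \<rho> x1],
     vector [a * \<rho> (\<rho> x1), a * \<rho> (\<rho> x2), \<rho> (\<rho> x0)]])"
  have "splitting {x. \<rho> x = x} A \<phi>"
    unfolding \<phi>_def by (rule splitting_exists) (simp_all add: add mult one cube base)
  then have "\<phi> (g \<otimes>\<^bsub>A\<^esub> g) = \<phi> g ** \<phi> g" "\<phi> (cyc_embed (- 1)) = mat (- 1)"
    using carrier_A one uminus[of 1] by (simp_all add: splitting_def)
  then have "\<phi> g ** \<phi> g = mat (- 1)"
    using sq by simp
  then have "det (\<phi> g) * det (\<phi> g) = det (mat (- 1) :: 'l^3^3)"
    by (metis det_mul)
  also have "\<dots> = - 1"
    by (simp add: det_3 mat_def)
  finally have "det (\<phi> g) * det (\<phi> g) = - 1" .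
  \<comment> \<open>In the expanded determinant \<open>\<rho>\<close> only permutes the terms: the
    three norms are fixed and the three mixed products are cycled.\<close>
  moreover have "\<rho> (det (\<phi> g)) = det (\<phi> g)"
    by (cases g) (simp add: \<phi>_def det_3 vector_3 add diff mult cube base algebra_simps)
  ultimately show thesis
    using that by blast
qed

end

section \<open>Eigenvectors of the involution\<close>

theorem theorem3p3:
  fixes F E M :: "'l::field_char_0 set"
    and \<rho> \<tau> :: "'l \<Rightarrow> 'l"
    and a b :: 'l
    and D :: "('l \<times> 'l \<times> 'l) ring"
    and \<alpha> :: "'l \<times> 'l \<times> 'l \<Rightarrow> 'l \<times> 'l \<times> 'l"
  assumes "number_field F" and "number_field E"
    and "F \<subseteq> E" and "ring.dimension field_of_type 2 F E"
    and "galois_over F" and "cyclic_group (galois_group F)" and "Coset.order (galois_group F) = 6"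
    and "\<rho> \<in> carrier (galois_group E)"
    and "generate (galois_group E) {\<rho>} = carrier (galois_group E)"
    and "\<tau> \<in> carrier (galois_group F)" and "group.ord (galois_group F) \<tau> = 2"
    and "M = {x. \<tau> x = x}"
    and "a \<in> ring_of_integers E - ring_of_integers F"
    and "a \<notin> field_norm UNIV E ` (UNIV - {0})"
    and "b \<in> M - {0}"
    and "field_norm E F a = field_norm M F b"
    and "D = cyclic_algebra \<rho> a"
    and "involution_second_kind E \<tau> D \<alpha>"
    and "\<And>l. \<alpha> (cyc_embed l) = cyc_embed (\<tau> l)"
    and "\<alpha> cyc_z = cyc_embed (b / a) \<otimes>\<^bsub>D\<^esub> (cyc_z \<otimes>\<^bsub>D\<^esub> cyc_z)"
  shows "(\<forall>g \<in> special_unitary_group E D \<alpha>. g \<noteq> \<one>\<^bsub>D\<^esub> \<longrightarrow> \<alpha> g \<noteq> g \<and> \<alpha> g \<noteq> \<ominus>\<^bsub>D\<^esub> g)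
    \<and> (\<forall>g \<in> unitary_group D \<alpha>.
          (\<alpha> g = g \<or> \<alpha> g = \<ominus>\<^bsub>D\<^esub> g) \<longleftrightarrow> (\<exists>\<zeta> \<in> E - {0}. \<zeta> ^ 4 = 1 \<and> g = cyc_embed \<zeta>))"
proof -
  note F = assms(1) and E = assms(2)
  have Esub: "subfield E field_of_type"
    using E by (simp add: number_field_def)
  note sextic = cyclic_sextic_galois[OF assms(5) Esub assms(3,4,6-9)]
  have \<rho>: "\<And>x y. \<rho> (x + y) = \<rho> x + \<rho> y" "\<And>x y. \<rho> (x * y) = \<rho> x * \<rho> y" "\<rho> 1 = 1"
    and \<rho>_E: "\<And>x. x \<in> E \<Longrightarrow> \<rho> x = x"
    using assms(8) by (auto simp: carrier_galois_group)
  have aE: "a \<in> E"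
    using assms(13) by (simp add: ring_of_integers_def)
  \<comment> \<open>The hypothesis on \<open>a\<close> excludes norms of nonzero elements only;
    \<open>a \<noteq> 0\<close> covers the remaining case \<open>c = 0\<close> of
    \<open>not_norm\<close>.\<close>
  have "0 \<in> ring_of_integers F"
    using F by (simp add: ring_of_integers_def number_field_def subfield_closed)
  with assms(13) have a0: "a \<noteq> 0"
    by auto
  interpret cyclic_cubic \<rho> a
  proof
    fix c
    show "a \<noteq> c * \<rho> c * \<rho> (\<rho> c)"
    proof
      assume *: "a = c * \<rho> c * \<rho> (\<rho> c)"
      with a0 have "c \<noteq> 0"
        by auto
      with * assms(14) show False
        by (auto simp: sextic(3))
    qed
  qed (simp_all add: \<rho> sextic(1) \<rho>_E aE)
  have D: "D = A"
    by (rule assms(17))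
  have one_D: "\<one>\<^bsub>D\<^esub> = cyc_embed 1"
    by (simp add: D cyclic_algebra_def cyc_embed_def)
  have embed_mult: "cyc_embed x \<otimes>\<^bsub>D\<^esub> cyc_embed y = cyc_embed (x * y)" for x y
    by (simp add: D cyclic_algebra_def cyc_embed_def zero)
  have embed_inv: "\<ominus>\<^bsub>D\<^esub> cyc_embed x = cyc_embed (- x)" for x
    by (simp add: D a_inv_A cyc_embed_def)
  have embed_inj: "cyc_embed x = cyc_embed y \<longleftrightarrow> x = y" for x y :: 'l
    by (simp add: cyc_embed_def)
  have eigen: "\<exists>\<zeta> \<in> E - {0}. \<zeta> ^ 4 = 1 \<and> g = cyc_embed \<zeta>"
    if g: "g \<in> unitary_group D \<alpha>" and \<alpha>: "\<alpha> g = g \<or> \<alpha> g = \<ominus>\<^bsub>D\<^esub> g" for g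
  proof -
    note car = carrier_A[of g]
    have "\<alpha> g \<otimes>\<^bsub>A\<^esub> g = cyc_embed 1"
      using g one_D by (simp add: unitary_group_def D)
    then have "g \<otimes>\<^bsub>A\<^esub> g = cyc_embed 1 \<or> \<ominus>\<^bsub>A\<^esub> (g \<otimes>\<^bsub>A\<^esub> g) = cyc_embed 1"
      using \<alpha> car by (auto simp: D l_minus)
    then have "g \<otimes>\<^bsub>A\<^esub> g = cyc_embed 1 \<or> g \<otimes>\<^bsub>A\<^esub> g = cyc_embed (- 1)"
      using car embed_inv[of 1] by (auto simp: D) (metis minus_minus m_closed)
    \<comment> \<open>If the square of \<open>g\<close> is the identity, take \<open>d = 1\<close>;
      otherwise \<open>d\<close> is a square root of \<open>- 1\<close> fixed by
      \<open>\<rho>\<close>. Both cases then continue alike.\<close>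
    then obtain d where d: "\<rho> d = d" "d * d = 1 \<or> d * d = - 1" "g \<otimes>\<^bsub>A\<^esub> g = cyc_embed (d * d)"
      using square_eq_minus_one \<rho>(3) by (metis mult_1)
    have "g = cyc_embed d \<or> g = cyc_embed (- d)"
      by (rule square_eq_scalar[OF d(3,1)])
    moreover have "d \<in> E" "- d \<in> E"
      using sextic(2) d(1) subfield_closed(5)[OF Esub] by auto
    moreover have "d ^ 4 = 1"
      using d(2) power_mult[of d 2 2] by (auto simp: power2_eq_square)
    moreover have "d \<noteq> 0"
      using d(2) by auto
    ultimately show ?thesis
      by (elim disjE) (auto intro: bexI[of _ d] bexI[of _ "- d"])
  qed
  have eigen_conv: "\<alpha> g = g \<or> \<alpha> g = \<ominus>\<^bsub>D\<^esub> g"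
    if g: "g \<in> unitary_group D \<alpha>" and \<zeta>: "\<zeta> ^ 4 = 1" "g = cyc_embed \<zeta>" for g \<zeta>
  proof -
    \<comment> \<open>Unitarity makes \<open>\<tau> \<zeta>\<close> the inverse of
      \<open>\<zeta>\<close>, and the inverse of a fourth root of unity with square \<open>1\<close>
      or \<open>- 1\<close> is \<open>\<zeta>\<close> or \<open>- \<zeta>\<close>.\<close>
    have unit: "\<tau> \<zeta> * \<zeta> = 1"
      using g \<zeta>(2) by (auto simp: unitary_group_def one_D assms(19) embed_mult embed_inj)
    have "(\<zeta>\<^sup>2)\<^sup>2 = 1"
      using \<zeta>(1) by (simp flip: power_mult)
    then have "\<zeta>\<^sup>2 = 1 \<or> \<zeta>\<^sup>2 = - 1"
      by (simp only: power2_eq_1_iff)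
    then have "\<zeta> * \<zeta> = \<tau> \<zeta> * \<zeta> \<or> - \<zeta> * \<zeta> = \<tau> \<zeta> * \<zeta>"
      by (auto simp: unit power2_eq_square)
    moreover have "\<zeta> \<noteq> 0"
      using unit by auto
    ultimately have "\<tau> \<zeta> = \<zeta> \<or> \<tau> \<zeta> = - \<zeta>"
      by (metis mult_right_cancel)
    then show ?thesis
      by (auto simp: \<zeta>(2) assms(19) embed_inv)
  qed
  have "g = \<one>\<^bsub>D\<^esub>"
    if g: "g \<in> special_unitary_group E D \<alpha>" and \<alpha>: "\<alpha> g = g \<or> \<alpha> g = \<ominus>\<^bsub>D\<^esub> g" for g
  proof -
    obtain \<zeta> where \<zeta>: "\<zeta> \<in> E" "\<zeta> ^ 4 = 1" "g = cyc_embed \<zeta>"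
      using eigen[OF _ \<alpha>] g by (auto simp: special_unitary_group_def)
    \<comment> \<open>Every splitting sends a scalar of \<open>E\<close> to a scalar matrix, so only
      existence matters here: whichever one is chosen, the reduced norm of \<open>\<zeta>\<close> is
      its cube.\<close>
    have "splitting E D (SOME \<phi>. splitting E D \<phi>)"
      unfolding D by (rule someI[of "splitting E A"], rule splitting_exists)
        (simp_all add: \<rho> sextic(1) \<rho>_E aE)
    then have "reduced_norm E D g = det (mat \<zeta> :: 'l^3^3)"
      using \<zeta> by (simp add: reduced_norm_def splitting_def)
    then have "\<zeta> ^ 3 = 1"
      using g by (simp add: special_unitary_group_def det_3 mat_def power3_eq_cube)
    then have "\<zeta> = 1"
      using \<zeta>(2) by (simp add: eval_nat_numeral)
    with \<zeta>(3) one_D show ?thesis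
      by simp
  qed
  with eigen eigen_conv show ?thesis
    by blast
qed

end
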